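(* Let $0<\alpha<\infty$ and let $(J_n)_{n\ge1}$ be an $\alpha$-kernel. Let $J=\sum_{n\ge1}J_n$ and $(\mathscr{L}_\alpha f)_n=\sum_{m\neq n}J_{|n-m|}(f_n-f_m)$. (Onsite) For any $\epsilon,\omega_A>0$ define $$q_0=\sqrt{\omega_A+2\epsilon J},\qquad q_n=\frac{\epsilon\left(J_nq_0+\sum_{m=1}^{n-1}(J_{n-m}+J_{n+m})q_m\right)}{\epsilon(2J-J_{2n})+\omega_A}\quad(n\ge1),\qquad q_{-n}=q_n .$$ Then, with $\rho=\epsilon/\omega_A$, $q_{n+1}=O(q_n)$ as $\rho\to0$ (for $n\ge0$), and $$\lim_{\rho\to0}\ \sup_{n\in\mathbb{Z}}\left|\frac{-\omega_Aq_n}{\epsilon(\mathscr{L}_\alpha q)_n-q_n^3}-1\right|=0 .$$ (Offsite) Similarly, for any $\epsilon,\omega_B>0$ define $$g_1=g_0=\sqrt{\omega_B+\epsilon(2J-J_1)},\qquad g_n=\frac{\epsilon\sum_{m=1}^{n-1}(J_{n-m}+J_{n+m-1})g_m}{\epsilon(2J-J_{2n-1})+\omega_B}\quad(n\ge2),\qquad g_n=g_{-(n-1)}\ (n\in\mathbb{Z}).$$ Then, with $\rho=\epsilon/\omega_B$, $g_{n+1}=O(g_n)$ as $\rho\to0$ (for $n\ge1$), and $$\lim_{\rho\to0}\ \sup_{n\in\mathbb{Z}}\left|\frac{-\omega_Bg_n}{\epsilon(\mathscr{L}_\alpha g)_n-g_n^3}-1\right|=0 .$$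
   Context: For $0<\alpha<\infty$, an $\alpha$-kernel is a sequence $J_n\ge0$ ($n\ge1$), not identically zero, with $\lim_{n\to\infty}n^{1+\alpha}J_n\in(0,\infty)$. The kernel is fixed while $\rho\to0$. The stationary equation being approximated is $-\omega Q_n=\epsilon(\mathscr{L}_\alpha Q)_n-Q_n^3$.
   Formalization: The onsite part additionally assumes J_n > 0 for all n ≥ 1, and the offsite part J_n + J_{n+1} > 0 for all n ≥ 1; without these the claim fails (e.g. J_1 = 0 gives q_1 = 0, so the supremum is at least 1). *)

theory Defs
  imports "HOL-Analysis.Analysis" "HOL-Library.Landau_Symbols"
begin

text \<open>Kernels are functions on \<^typ>\<open>nat\<close> of which only the values at \<open>n \<ge> 1\<close> matter; the value at
  \<open>0\<close> is never used below.\<close>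

definition alpha_kernel :: "real \<Rightarrow> (nat \<Rightarrow> real) \<Rightarrow> bool" where
  "alpha_kernel \<alpha> J \<longleftrightarrow>
     (\<forall>n\<ge>1. 0 \<le> J n) \<and> (\<exists>n\<ge>1. J n \<noteq> 0) \<and>
     (\<exists>l>0. (\<lambda>n. real n powr (1 + \<alpha>) * J n) \<longlonglongrightarrow> l)"

text \<open>Finitely many values of an \<open>\<alpha>\<close>-kernel may be \<open>0\<close>. If \<open>J 1 = 0\<close>, the onsite sequence has
  \<open>q\<^sub>1 = 0\<close>, so that the quotient of the asserted limit is \<open>0\<close>, not close to \<open>1\<close>, at \<open>n = 1\<close>; if
  \<open>J k = 0 < J (k + 1)\<close>, then \<open>q\<^sub>k\<close> is at most of order \<open>\<rho>\<^sup>2\<close> but \<open>q\<^bsub>k+1\<^esub>\<close> of order \<open>\<rho>\<close> relative to \<open>q\<^sub>0\<close>.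
  The theorem therefore assumes \<open>J n > 0\<close> in the onsite case and, for the same reason,
  \<open>J n + J (n + 1) > 0\<close> in the offsite case, for all \<open>n \<ge> 1\<close>.\<close>

definition kernel_sum :: "(nat \<Rightarrow> real) \<Rightarrow> real" where
  "kernel_sum J = (\<Sum>\<^sub>\<infinity>n\<in>{1..}. J n)"

definition nonlocal_op :: "(nat \<Rightarrow> real) \<Rightarrow> (int \<Rightarrow> real) \<Rightarrow> int \<Rightarrow> real" where
  "nonlocal_op J f n = (\<Sum>\<^sub>\<infinity>m\<in>- {n}. J (nat \<bar>n - m\<bar>) * (f n - f m))"

fun onsite_nat :: "(nat \<Rightarrow> real) \<Rightarrow> real \<Rightarrow> real \<Rightarrow> nat \<Rightarrow> real" where
  "onsite_nat J \<epsilon> \<omega> n =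
     (if n = 0 then sqrt (\<omega> + 2 * \<epsilon> * kernel_sum J)
      else \<epsilon> * (J n * onsite_nat J \<epsilon> \<omega> 0
                + (\<Sum>m\<in>{1..<n}. (J (n - m) + J (n + m)) * onsite_nat J \<epsilon> \<omega> m))
           / (\<epsilon> * (2 * kernel_sum J - J (2 * n)) + \<omega>))"

definition onsite :: "(nat \<Rightarrow> real) \<Rightarrow> real \<Rightarrow> real \<Rightarrow> int \<Rightarrow> real" where
  "onsite J \<epsilon> \<omega> n = onsite_nat J \<epsilon> \<omega> (nat \<bar>n\<bar>)"

fun offsite_nat :: "(nat \<Rightarrow> real) \<Rightarrow> real \<Rightarrow> real \<Rightarrow> nat \<Rightarrow> real" where
  "offsite_nat J \<epsilon> \<omega> n =
     (if n \<le> 1 then sqrt (\<omega> + \<epsilon> * (2 * kernel_sum J - J 1))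
      else \<epsilon> * (\<Sum>m\<in>{1..<n}. (J (n - m) + J (n + m - 1)) * offsite_nat J \<epsilon> \<omega> m)
           / (\<epsilon> * (2 * kernel_sum J - J (2 * n - 1)) + \<omega>))"

definition offsite :: "(nat \<Rightarrow> real) \<Rightarrow> real \<Rightarrow> real \<Rightarrow> int \<Rightarrow> real" where
  "offsite J \<epsilon> \<omega> n = offsite_nat J \<epsilon> \<omega> (nat (if n \<ge> 1 then n else - (n - 1)))"

text \<open>The simp rules loop, as the right-hand sides contain unguarded recursive calls.\<close>

declare onsite_nat.simps [simp del] offsite_nat.simps [simp del]

text \<open>The limit \<open>\<rho> = \<epsilon> / \<omega> \<rightarrow> 0\<close> over all pairs \<open>(\<epsilon>, \<omega>)\<close> of positive reals: an eventual property
  holds for all \<open>\<epsilon>, \<omega> > 0\<close> with \<open>\<epsilon> / \<omega>\<close> below a threshold depending on neither \<open>\<epsilon>\<close> nor \<open>\<omega>\<close>.\<close>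

definition ratio_to_0 :: "(real \<times> real) filter" where
  "ratio_to_0 = inf (filtercomap (\<lambda>(\<epsilon>, \<omega>). \<epsilon> / \<omega>) (nhds 0)) (principal {(\<epsilon>, \<omega>). 0 < \<epsilon> \<and> 0 < \<omega>})"

text \<open>The supremum is taken in \<^typ>\<open>ereal\<close>, so that it is \<open>\<infinity>\<close> for an unbounded family. A vanishing
  denominator contributes \<open>\<bar>0 - 1\<bar> = 1\<close> and hence is not compatible with the limit being \<open>0\<close>.\<close>

definition stationary_defect ::
    "(nat \<Rightarrow> real) \<Rightarrow> real \<Rightarrow> real \<Rightarrow> (int \<Rightarrow> real) \<Rightarrow> ereal" where
  "stationary_defect J \<epsilon> \<omega> f =
     (SUP n. ereal \<bar>(- \<omega> * f n) / (\<epsilon> * nonlocal_op J f n - f n ^ 3) - 1\<bar>)"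

end

theory Submission
  imports Defs
begin

text \<open>At a site \<open>n\<close>, let \<open>T\<^sub>n\<close> be the interaction with the sites further from the centre. By the
  recursion, the quotient is \<open>1 / (1 + \<rho> T\<^sub>n / q\<^sub>n + q\<^sub>n\<^sup>2 / \<omega>)\<close>, the last summand being absent at the
  centre. For small \<open>\<rho>\<close> the recursion gives \<open>q\<^sub>n \<approx> \<rho> q\<^sub>0 n powr - (1 + \<alpha>)\<close> up to constant factors: the
  lower bound comes from the interaction with the centre alone, the upper bound by induction, as
  \<open>n powr - (1 + \<alpha>)\<close> is stable under convolution. Hence \<open>T\<^sub>n = O(q\<^sub>n)\<close> uniformly in \<open>n\<close>, and the defect is
  \<open>O(\<rho>)\<close>.\<close>

section \<open>Power weights and their convolution\<close>

definition decay :: "real \<Rightarrow> nat \<Rightarrow> real" where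
  "decay s n = real n powr (- s)"

lemma decay_nonneg [simp]: "0 \<le> decay s n"
  by (simp add: decay_def)

lemma decay_pos: "0 < n \<Longrightarrow> 0 < decay s n"
  by (simp add: decay_def)

lemma decay_0 [simp]: "decay s 0 = 0"
  by (simp add: decay_def)

lemma decay_antimono: "0 \<le> s \<Longrightarrow> 0 < m \<Longrightarrow> m \<le> n \<Longrightarrow> decay s n \<le> decay s m"
  by (simp add: decay_def powr_mono2')

lemma decay_le_1: "0 \<le> s \<Longrightarrow> decay s n \<le> 1"
  using decay_antimono[of s 1 n] by (cases "n = 0") (auto simp: decay_def)

lemma decay_summable:
  assumes "1 < s"
  shows "decay s summable_on A"
proof -
  have "summable (decay s)"
    using assms by (simp add: decay_def[abs_def] summable_real_powr_iff)
  then have "decay s summable_on UNIV"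
    by (intro norm_summable_imp_summable_on) simp
  then show ?thesis
    by (rule summable_on_subset_banach) simp
qed

text \<open>The larger of \<open>a\<close> and \<open>b\<close> is at least half of
  \<open>a + b\<close>, so its weight is at most \<open>2 powr s * decay s (a + b)\<close>; the
  other weight is kept. If one of them is \<open>0\<close>, the left side vanishes because
  \<open>decay s 0 = 0\<close>.\<close>

lemma decay_mult_le:
  assumes "0 \<le> s"
  shows "decay s a * decay s b \<le> 2 powr s * decay s (a + b) * (decay s a + decay s b)"
proof -
  have *: "decay s a * decay s b \<le> 2 powr s * decay s (a + b) * decay s a"
    if "a \<le> b" for a b
  proof (cases "a = 0")
    case False
    have "decay s b \<le> (real (a + b) / 2) powr (- s)"
      unfolding decay_def using that False assms by (intro powr_mono2') auto
    also have "\<dots> = 2 powr s * decay s (a + b)"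
      unfolding decay_def using False
      by (subst powr_divide) (auto simp: powr_minus field_simps)
    finally show ?thesis
      by (metis decay_nonneg mult.commute mult_left_mono)
  qed simp
  show ?thesis
  proof (cases "a \<le> b")
    case True
    from *[OF this] show ?thesis
      by (rule order_trans) (intro mult_left_mono, auto)
  next
    case False
    then have "decay s b * decay s a \<le> 2 powr s * decay s (b + a) * decay s b"
      by (intro *) auto
    also have "\<dots> \<le> 2 powr s * decay s (b + a) * (decay s a + decay s b)"
      by (intro mult_left_mono) auto
    finally show ?thesis
      by (simp add: mult.commute add.commute)
  qed
qed

text \<open>Termwise, \<open>decay_mult_le\<close> pulls out \<open>decay s n\<close> and leaves two
  partial sums of the weights, each at most the total. These two sums account for the
  \<open>+ 1\<close> in the exponent.\<close>

lemma decay_convolution_le: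
  assumes "1 < s"
  shows "(\<Sum>m\<in>{1..<n}. decay s (n - m) * decay s m)
           \<le> 2 powr (s + 1) * infsum (decay s) UNIV * decay s n"
proof -
  let ?Z = "infsum (decay s) UNIV"
  have le: "sum (decay s) A \<le> ?Z" if "finite A" for A
    by (rule finite_sum_le_infsum) (auto intro: decay_summable assms that)
  have "(\<Sum>m\<in>{1..<n}. decay s (n - m) * decay s m)
          \<le> (\<Sum>m\<in>{1..<n}. 2 powr s * decay s n * (decay s (n - m) + decay s m))"
  proof (rule sum_mono)
    fix m assume "m \<in> {1..<n}"
    then show "decay s (n - m) * decay s m
                 \<le> 2 powr s * decay s n * (decay s (n - m) + decay s m)"
      using decay_mult_le[of s "n - m" m] assms by auto
  qed
  also have "\<dots> = 2 powr s * decay s n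
      * ((\<Sum>m\<in>{1..<n}. decay s (n - m)) + (\<Sum>m\<in>{1..<n}. decay s m))"
    by (simp only: sum_distrib_left[symmetric] sum.distrib)
  also have "(\<Sum>m\<in>{1..<n}. decay s (n - m)) = (\<Sum>m\<in>{1..<n}. decay s m)"
    by (rule sum.reindex_bij_witness[of _ "\<lambda>m. n - m" "\<lambda>m. n - m"]) auto
  also have "2 powr s * decay s n * ((\<Sum>m\<in>{1..<n}. decay s m) + (\<Sum>m\<in>{1..<n}. decay s m))
      \<le> 2 powr s * decay s n * (?Z + ?Z)"
    by (intro mult_left_mono add_mono le) auto
  also have "\<dots> = 2 powr (s + 1) * ?Z * decay s n"
    by (simp add: powr_add)
  finally show ?thesis .
qed

section \<open>Constants determined by the kernel alone\<close>

text \<open>\<open>K i j\<close> is the total coupling of a site of index \<open>i\<close> to the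
  sites of index \<open>j\<close>, with \<open>s = 1 + \<alpha>\<close> and
  \<open>S = kernel_sum J\<close> in both applications. Since \<open>\<epsilon>\<close> and
  \<open>\<omega>\<close> enter only in \<open>profile\<close>, every constant defined here is
  uniform in them.\<close>

locale kernel_estimates =
  fixes K :: "nat \<Rightarrow> nat \<Rightarrow> real" and s C c S :: real
  assumes s: "1 < s" and C: "0 < C" and c: "0 < c"
    and K_nonneg: "0 \<le> K i j"
    and K_below: "j < i \<Longrightarrow> K i j \<le> C * decay s (i - j)"
    and K_above: "i < j \<Longrightarrow> K i j \<le> C * decay s (j - i)"
    and K_lower: "0 < i \<Longrightarrow> c * decay s i \<le> K i 0"
    and K_diag: "K i i \<le> S"
begin

definition Z :: real where "Z = infsum (decay s) UNIV"

text \<open>Below this ratio, the convolution term in the induction for \<open>q_upper\<close> is at most as large as the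
  contribution of the centre.\<close>

definition threshold :: real where
  "threshold = min 1 (1 / (2 * C * (2 powr (s + 1) * Z)))"

text \<open>\<open>2 * C * (1 + 2 * S) / c\<close> is the quotient of the constants in
  \<open>q_upper\<close> and \<open>q_lower\<close>; the extra \<open>2 * C\<close> covers
  comparison with \<open>q 0\<close>.\<close>

definition ratio_bound :: real where
  "ratio_bound = 2 * C * (1 + (1 + 2 * S) / c)"

text \<open>The first summand comes from \<open>tail_bounds\<close>, the second from the cube via
  \<open>q_square_le\<close>, both relative to \<open>\<omega> * q i\<close> and per unit of
  \<open>\<rho>\<close>.\<close>

definition defect_bound :: real where
  "defect_bound = C * Z * ratio_bound + (2 * C)\<^sup>2 * (1 + 2 * S)"

lemma S_nonneg: "0 \<le> S"
  using K_nonneg[of 0 0] K_diag[of 0] by simp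

lemma Z_pos: "0 < Z"
proof -
  have "sum (decay s) {1} \<le> Z"
    unfolding Z_def by (rule finite_sum_le_infsum) (auto intro: decay_summable s)
  then show ?thesis
    using decay_pos[of 1 s] by simp
qed

lemma threshold_pos: "0 < threshold"
  using C Z_pos by (auto simp: threshold_def)

lemma ratio_bound_ge: "2 * C \<le> ratio_bound" "2 * C * (1 + 2 * S) / c \<le> ratio_bound"
  using C c S_nonneg by (auto simp: ratio_bound_def algebra_simps)

end

section \<open>Two-sided bounds for the profile\<close>

locale profile = kernel_estimates +
  fixes \<epsilon> \<omega> :: real and q :: "nat \<Rightarrow> real"
  assumes \<epsilon>: "0 < \<epsilon>" and \<omega>: "0 < \<omega>" and small: "\<epsilon> / \<omega> < threshold"
    and q_0: "q 0 = sqrt (\<omega> + \<epsilon> * (2 * S - K 0 0))"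
    and q_rec: "0 < i \<Longrightarrow>
      q i = \<epsilon> * (\<Sum>j<i. K i j * q j) / (\<epsilon> * (2 * S - K i i) + \<omega>)"
begin

abbreviation \<rho> :: real where "\<rho> \<equiv> \<epsilon> / \<omega>"

lemma \<rho>: "0 < \<rho>" "\<rho> < 1" "\<rho> * (2 * C * (2 powr (s + 1) * Z)) \<le> 1"
  using \<epsilon> \<omega> small C Z_pos by (auto simp: threshold_def field_simps)

text \<open>The lower bound rests on \<open>K i i \<le> S\<close>, the upper one on
  \<open>\<epsilon> \<le> \<omega>\<close>, which holds as the threshold is at most
  \<open>1\<close>. For \<open>i = 0\<close> the expression is the radicand of
  \<open>q 0\<close>.\<close>

lemma denom: "\<omega> \<le> \<epsilon> * (2 * S - K i i) + \<omega>" "\<epsilon> * (2 * S - K i i) + \<omega> \<le> \<omega> * (1 + 2 * S)"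
proof -
  have "0 \<le> 2 * S - K i i" "2 * S - K i i \<le> 2 * S"
    using K_diag[of i] K_nonneg[of i i] S_nonneg by auto
  moreover have "\<epsilon> \<le> \<omega>"
    using \<rho>(2) \<omega> by (simp add: field_simps)
  ultimately have "\<epsilon> * (2 * S - K i i) \<le> \<omega> * (2 * S)" "0 \<le> \<epsilon> * (2 * S - K i i)"
    using \<epsilon> \<omega> by (auto intro!: mult_mono)
  then show "\<omega> \<le> \<epsilon> * (2 * S - K i i) + \<omega>" "\<epsilon> * (2 * S - K i i) + \<omega> \<le> \<omega> * (1 + 2 * S)"
    by (auto simp: algebra_simps)
qed

lemma q_0_pos: "0 < q 0"
  using denom(1)[of 0] \<omega> by (simp add: q_0 add.commute)

lemma q_0_square: "(q 0)\<^sup>2 = \<omega> + \<epsilon> * (2 * S - K 0 0)"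
  using denom(1)[of 0] \<omega> by (simp add: q_0 add.commute)

lemma q_nonneg: "0 \<le> q i"
proof (induction i rule: less_induct)
  case (less i)
  show ?case
  proof (cases "i = 0")
    case True
    then show ?thesis using q_0_pos by simp
  next
    case False
    then have "0 \<le> (\<Sum>j<i. K i j * q j)"
      using less by (intro sum_nonneg mult_nonneg_nonneg K_nonneg) auto
    then show ?thesis
      using q_rec[of i] False \<epsilon> \<omega> denom(1)[of i] by simp
  qed
qed

text \<open>All terms of the recursion are nonnegative, so the term \<open>j = 0\<close> alone
  bounds the sum from below; \<open>1 + 2 * S\<close> is the price of the denominator.\<close>

lemma q_lower:
  assumes "0 < i"
  shows "\<rho> * q 0 * decay s i * (c / (1 + 2 * S)) \<le> q i"
proof -
  have "K i 0 * q 0 \<le> (\<Sum>j<i. K i j * q j)"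
    using assms sum_mono2[of "{..<i}" "{0}" "\<lambda>j. K i j * q j"] K_nonneg q_nonneg by auto
  moreover have "c * decay s i * q 0 \<le> K i 0 * q 0"
    using K_lower[OF assms] q_nonneg by (rule mult_right_mono)
  ultimately have "c * decay s i * q 0 \<le> (\<Sum>j<i. K i j * q j)"
    by simp
  moreover have "0 \<le> c * decay s i * q 0"
    using c q_nonneg[of 0] by simp
  ultimately have "\<epsilon> * (c * decay s i * q 0) / (\<omega> * (1 + 2 * S)) \<le> q i"
    unfolding q_rec[OF assms] using \<epsilon> \<omega> denom[of i]
    by (intro frac_le mult_left_mono mult_nonneg_nonneg) auto
  then show ?thesis
    by (simp add: mult_ac)
qed

lemma q_pos: "0 < q i"
proof (cases "i = 0")
  case False
  then have "0 < \<rho> * q 0 * decay s i * (c / (1 + 2 * S))"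
    using c S_nonneg \<epsilon> \<omega> q_0_pos decay_pos[of i s]
    by (intro mult_pos_pos divide_pos_pos) auto
  with q_lower[of i] False show ?thesis by simp
qed (use q_0_pos in simp)

text \<open>Half of the constant \<open>2 * C\<close> pays for the centre, the other half for the
  convolution of the induction hypothesis with the kernel.\<close>

lemma q_upper: "0 < i \<Longrightarrow> q i \<le> 2 * C * \<rho> * q 0 * decay s i"
proof (induction i rule: less_induct)
  case (less i)
  have "(\<Sum>j<i. K i j * q j) \<le> (\<Sum>j<i. C * decay s (i - j) * q j)"
    by (intro sum_mono mult_right_mono q_nonneg K_below) auto
  \<comment> \<open>The centre is split off because the induction hypothesis covers positive indices
    only.\<close>
  also have "(\<Sum>j<i. C * decay s (i - j) * q j)
      = (\<Sum>j\<in>insert 0 {1..<i}. C * decay s (i - j) * q j)"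
    using less.prems by (intro sum.cong) auto
  also have "\<dots> = C * decay s i * q 0 + (\<Sum>j\<in>{1..<i}. C * decay s (i - j) * q j)"
    by simp
  also have "(\<Sum>j\<in>{1..<i}. C * decay s (i - j) * q j)
      \<le> (\<Sum>j\<in>{1..<i}. C * decay s (i - j) * (2 * C * \<rho> * q 0 * decay s j))"
    using C by (intro sum_mono mult_left_mono less.IH) auto
  also have "\<dots> = C * q 0 * (\<rho> * (2 * C)) * (\<Sum>j\<in>{1..<i}. decay s (i - j) * decay s j)"
    by (simp add: sum_distrib_left mult_ac)
  also have "\<dots> \<le> C * q 0 * (\<rho> * (2 * C)) * (2 powr (s + 1) * Z * decay s i)"
    unfolding Z_def using C \<epsilon> \<omega> q_nonneg[of 0] s
    by (intro mult_left_mono decay_convolution_le) auto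
  also have "\<dots> = C * q 0 * decay s i * (\<rho> * (2 * C * (2 powr (s + 1) * Z)))"
    by (simp only: mult_ac)
  also have "\<dots> \<le> C * q 0 * decay s i * 1"
    using \<rho>(3) C q_nonneg[of 0] by (intro mult_left_mono) auto
  finally have "(\<Sum>j<i. K i j * q j) \<le> 2 * C * q 0 * decay s i"
    by (simp add: mult_ac)
  then have "q i \<le> \<epsilon> * (2 * C * q 0 * decay s i) / \<omega>"
    unfolding q_rec[OF less.prems] using \<epsilon> \<omega> denom(1)[of i] C q_nonneg[of 0]
    by (intro frac_le mult_left_mono mult_nonneg_nonneg) auto
  then show ?case
    by (simp add: mult_ac)
qed

lemma decay_le_q:
  assumes "0 < i"
  shows "2 * C * \<rho> * q 0 * decay s i \<le> ratio_bound * q i"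
proof -
  have D: "1 + 2 * S \<noteq> 0"
    using S_nonneg by simp
  have "2 * C * \<rho> * q 0 * decay s i
      = 2 * C * (1 + 2 * S) / c * (\<rho> * q 0 * decay s i * (c / (1 + 2 * S)))"
    using c D by (simp only: times_divide_times_eq times_divide_eq_left times_divide_eq_right) simp
  also have "\<dots> \<le> 2 * C * (1 + 2 * S) / c * q i"
    using q_lower[OF assms] C c S_nonneg by (intro mult_left_mono) auto
  also have "\<dots> \<le> ratio_bound * q i"
    using ratio_bound_ge(2) q_nonneg by (rule mult_right_mono)
  finally show ?thesis .
qed

text \<open>The case \<open>j = Suc i\<close> is the claimed growth estimate; the full range of
  \<open>j\<close> controls the tail sum. Off the centre, \<open>q_upper\<close> at
  \<open>j\<close>, monotonicity of the weights and \<open>decay_le_q\<close> at \<open>i\<close>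
  are chained.\<close>

lemma q_above:
  assumes "i < j"
  shows "q j \<le> ratio_bound * q i"
proof (cases "i = 0")
  case True
  have "q j \<le> 2 * C * q 0 * (\<rho> * decay s j)"
    using q_upper[of j] assms by (simp add: mult_ac)
  \<comment> \<open>At the centre there is no weight to compare with, so \<open>\<rho>\<close> and
    the weight are both bounded by \<open>1\<close>.\<close>
  also have "\<dots> \<le> 2 * C * q 0 * (1 * 1)"
    using \<rho> C s q_nonneg[of 0] decay_le_1[of s j] by (intro mult_left_mono mult_mono) auto
  also have "\<dots> \<le> ratio_bound * q 0"
    using ratio_bound_ge(1) q_nonneg[of 0] by (simp add: mult_right_mono)
  finally show ?thesis
    using True by simp
next
  case False
  have "q j \<le> 2 * C * \<rho> * q 0 * decay s j"
    using q_upper assms by simp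
  also have "\<dots> \<le> 2 * C * \<rho> * q 0 * decay s i"
    using assms False s C \<epsilon> \<omega> q_nonneg[of 0] by (intro mult_left_mono decay_antimono) auto
  also have "\<dots> \<le> ratio_bound * q i"
    using decay_le_q False by simp
  finally show ?thesis .
qed

lemma q_bounded: "\<exists>M. \<forall>j. \<bar>q j\<bar> \<le> M"
proof -
  have "\<bar>q j\<bar> \<le> max (q 0) (ratio_bound * q 0)" for j
    using q_above[of 0 j] q_nonneg[of j] by (cases "j = 0") auto
  then show ?thesis by blast
qed

text \<open>\<open>q i\<close> is at most of order \<open>\<rho> * q 0\<close>, and
  \<open>(q 0)\<^sup>2\<close> is of order \<open>\<omega>\<close>. One of the two factors
  \<open>\<rho>\<close> is given up, since first order suffices.\<close>

lemma q_square_le: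
  assumes "0 < i"
  shows "(q i)\<^sup>2 \<le> \<omega> * ((2 * C)\<^sup>2 * (1 + 2 * S) * \<rho>)"
proof -
  have "q i \<le> 2 * C * \<rho> * q 0 * decay s i"
    using q_upper assms by simp
  also have "\<dots> \<le> 2 * C * \<rho> * q 0 * 1"
    using C \<epsilon> \<omega> q_nonneg[of 0] s by (intro mult_left_mono decay_le_1) auto
  finally have "(q i)\<^sup>2 \<le> (2 * C * \<rho> * q 0)\<^sup>2"
    using q_nonneg[of i] by (intro power_mono) auto
  also have "\<dots> = (2 * C)\<^sup>2 * (\<rho> * \<rho>) * (q 0)\<^sup>2"
    by (simp add: power2_eq_square)
  also have "(q 0)\<^sup>2 = \<omega> + \<epsilon> * (2 * S - K 0 0)"
    by (rule q_0_square)
  also have "(2 * C)\<^sup>2 * (\<rho> * \<rho>) * (\<omega> + \<epsilon> * (2 * S - K 0 0))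
      \<le> (2 * C)\<^sup>2 * (\<rho> * 1) * (\<omega> * (1 + 2 * S))"
    using \<rho> denom[of 0] \<epsilon> \<omega> by (intro mult_mono mult_left_mono) (auto simp: add.commute)
  finally show ?thesis
    by (simp add: mult_ac)
qed

section \<open>Tail interaction and defect at one site\<close>

text \<open>Beyond \<open>i\<close> every value is at most \<open>ratio_bound * q i\<close>, and the
  kernel bound is summable in the distance \<open>j - i\<close>. Measuring the tail in units of
  \<open>q i\<close> makes the estimate uniform over the sites.\<close>

lemma tail_bounds:
  shows "(\<lambda>j. K i j * q j) summable_on {i<..}"
    and "0 \<le> (\<Sum>\<^sub>\<infinity>j\<in>{i<..}. K i j * q j)"
    and "(\<Sum>\<^sub>\<infinity>j\<in>{i<..}. K i j * q j) \<le> C * Z * ratio_bound * q i"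
proof -
  let ?w = "\<lambda>j. C * ratio_bound * q i * decay s (j - i)"
  have le: "K i j * q j \<le> ?w j" if "j \<in> {i<..}" for j
  proof -
    have "K i j * q j \<le> C * decay s (j - i) * (ratio_bound * q i)"
      using that C by (intro mult_mono K_above q_above q_nonneg) auto
    then show ?thesis
      by (simp add: mult_ac)
  qed
  have bij: "bij_betw (\<lambda>k. i + k) {0<..} {i<..}"
    by (rule bij_betwI[of _ _ _ "\<lambda>j. j - i"]) auto
  have "?w summable_on {i<..} \<longleftrightarrow> (\<lambda>k. ?w (i + k)) summable_on {0<..}"
    by (rule summable_on_reindex_bij_betw[OF bij, symmetric])
  then have w: "?w summable_on {i<..}"
    by (simp add: summable_on_cmult_right decay_summable s)
  then show summ: "(\<lambda>j. K i j * q j) summable_on {i<..}"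
    by (rule summable_on_comparison_test) (auto intro: le mult_nonneg_nonneg K_nonneg q_nonneg)
  show "0 \<le> (\<Sum>\<^sub>\<infinity>j\<in>{i<..}. K i j * q j)"
    by (intro infsum_nonneg mult_nonneg_nonneg K_nonneg q_nonneg)
  have "(\<Sum>\<^sub>\<infinity>j\<in>{i<..}. K i j * q j) \<le> infsum ?w {i<..}"
    by (intro infsum_mono summ w le)
  also have "infsum ?w {i<..} = (\<Sum>\<^sub>\<infinity>k\<in>{0<..}. ?w (i + k))"
    by (rule infsum_reindex_bij_betw[OF bij, symmetric])
  also have "\<dots> = C * ratio_bound * q i * infsum (decay s) {0<..}"
    by (simp add: infsum_cmult_right decay_summable s)
  \<comment> \<open>The index \<open>0\<close> may be added, as its weight is
    \<open>0\<close>.\<close>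
  also have "infsum (decay s) {0<..} = Z"
    unfolding Z_def by (rule infsum_cong_neutral) auto
  finally show "(\<Sum>\<^sub>\<infinity>j\<in>{i<..}. K i j * q j) \<le> C * Z * ratio_bound * q i"
    by (simp add: mult_ac)
qed

text \<open>The profile solves the stationary equation with the interaction beyond \<open>i\<close>
  dropped and, off the centre, the cube as well. The recursion cancels the terms
  \<open>j \<le> i\<close>; at the centre, \<open>q_0_square\<close> makes the cube linear.\<close>

lemma residual:
  "\<epsilon> * (2 * S * q i - (\<Sum>\<^sub>\<infinity>j. K i j * q j)) - (q i) ^ 3
     = - (\<omega> * q i + \<epsilon> * (\<Sum>\<^sub>\<infinity>j\<in>{i<..}. K i j * q j) + (if i = 0 then 0 else (q i) ^ 3))"
proof -
  let ?T = "\<Sum>\<^sub>\<infinity>j\<in>{i<..}. K i j * q j"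
  have "(UNIV :: nat set) = {..i} \<union> {i<..}"
    by auto
  then have "(\<Sum>\<^sub>\<infinity>j. K i j * q j) = (\<Sum>\<^sub>\<infinity>j\<in>{..i} \<union> {i<..}. K i j * q j)"
    by simp
  also have "\<dots> = (\<Sum>\<^sub>\<infinity>j\<in>{..i}. K i j * q j) + ?T"
    by (rule infsum_Un_disjoint) (auto intro: tail_bounds(1))
  also have "(\<Sum>\<^sub>\<infinity>j\<in>{..i}. K i j * q j) = (\<Sum>j<i. K i j * q j) + K i i * q i"
    by (simp add: lessThan_Suc_atMost[symmetric])
  finally have eq: "(\<Sum>\<^sub>\<infinity>j. K i j * q j) = (\<Sum>j<i. K i j * q j) + K i i * q i + ?T"
    by simp
  show ?thesis
  proof (cases "i = 0")
    case True
    have "(q 0) ^ 3 = q 0 * (\<omega> + \<epsilon> * (2 * S - K 0 0))"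
      by (simp add: q_0_square[symmetric] power2_eq_square power3_eq_cube)
    then show ?thesis
      unfolding eq using True by (simp add: algebra_simps)
  next
    case False
    have "q i * (\<epsilon> * (2 * S - K i i) + \<omega>) = \<epsilon> * (\<Sum>j<i. K i j * q j)"
      using False q_rec[of i] denom(1)[of i] \<omega> by simp
    then show ?thesis
      unfolding eq using False by (simp add: algebra_simps)
  qed
qed

text \<open>With \<open>a = \<omega> * q i\<close> and the error \<open>E\<close> from
  \<open>residual\<close>, the quotient is \<open>a / (a + E)\<close>, which differs from
  \<open>1\<close> by \<open>E / (a + E)\<close>. As \<open>E\<close> is nonnegative and
  \<open>a\<close> positive, the denominator never vanishes.\<close>

lemma defect_le:
  "\<bar>(- \<omega> * q i) / (\<epsilon> * (2 * S * q i - (\<Sum>\<^sub>\<infinity>j. K i j * q j)) - (q i) ^ 3) - 1\<bar>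
     \<le> defect_bound * \<rho>"
proof -
  define T where "T = (\<Sum>\<^sub>\<infinity>j\<in>{i<..}. K i j * q j)"
  define E where "E = \<epsilon> * T + (if i = 0 then 0 else (q i) ^ 3)"
  define a where "a = \<omega> * q i"
  have a: "0 < a"
    using \<omega> q_pos by (simp add: a_def)
  have E0: "0 \<le> E"
    using tail_bounds(2)[of i] \<epsilon> q_nonneg[of i] by (auto simp: E_def T_def)
  have "\<epsilon> * T \<le> \<epsilon> * (C * Z * ratio_bound * q i)"
    unfolding T_def using \<epsilon> by (intro mult_left_mono tail_bounds) auto
  also have "\<dots> = C * Z * ratio_bound * \<rho> * a"
    using \<omega> by (simp add: a_def)
  finally have "\<epsilon> * T \<le> C * Z * ratio_bound * \<rho> * a" .
  moreover have "(if i = 0 then 0 else (q i) ^ 3) \<le> (2 * C)\<^sup>2 * (1 + 2 * S) * \<rho> * a"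
  proof (cases "i = 0")
    case True
    then show ?thesis
      using a \<rho>(1) S_nonneg C by (simp del: times_divide_eq_right times_divide_eq_left)
  next
    case False
    have "(q i) ^ 3 = (q i)\<^sup>2 * q i"
      by (simp add: power2_eq_square power3_eq_cube)
    also have "\<dots> \<le> \<omega> * ((2 * C)\<^sup>2 * (1 + 2 * S) * \<rho>) * q i"
      using False by (intro mult_right_mono q_square_le q_nonneg) auto
    finally show ?thesis
      using False by (simp only: a_def mult_ac if_False)
  qed
  ultimately have E: "E \<le> defect_bound * \<rho> * a"
    unfolding E_def defect_bound_def by (simp add: algebra_simps)
  have "(- \<omega> * q i) / (\<epsilon> * (2 * S * q i - (\<Sum>\<^sub>\<infinity>j. K i j * q j)) - (q i) ^ 3) - 1
          = (- a) / (- (a + E)) - 1"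
    unfolding residual by (simp add: a_def E_def T_def add.assoc)
  also have "\<dots> = - (E / (a + E))"
    using a E0 by (simp add: field_simps)
  finally have "\<bar>(- \<omega> * q i) / (\<epsilon> * (2 * S * q i - (\<Sum>\<^sub>\<infinity>j. K i j * q j)) - (q i) ^ 3) - 1\<bar>
      = E / (a + E)"
    using a E0 by simp
  also have "\<dots> \<le> E / a"
    using a E0 by (intro divide_left_mono) auto
  also have "\<dots> \<le> defect_bound * \<rho>"
    using E a by (simp add: pos_divide_le_eq)
  finally show ?thesis .
qed

end

section \<open>The lattice operator on symmetric sequences\<close>

lemma lattice_kernel_has_sum:
  assumes "J summable_on {1..}"
  shows "((\<lambda>m. J (nat \<bar>n - m\<bar>)) has_sum 2 * kernel_sum J) (- {n})"
proof -
  have J: "(J has_sum kernel_sum J) {1..}"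
    unfolding kernel_sum_def using assms by (rule has_sum_infsum)
  have "bij_betw (\<lambda>k. n + int k) {1..} {n<..}"
    by (rule bij_betwI[of _ _ _ "\<lambda>m. nat (m - n)"]) auto
  from has_sum_reindex_bij_betw[OF this, of "\<lambda>m. J (nat \<bar>n - m\<bar>)"] J
  have right: "((\<lambda>m. J (nat \<bar>n - m\<bar>)) has_sum kernel_sum J) {n<..}"
    by simp
  have "bij_betw (\<lambda>k. n - int k) {1..} {..<n}"
    by (rule bij_betwI[of _ _ _ "\<lambda>m. nat (n - m)"]) auto
  from has_sum_reindex_bij_betw[OF this, of "\<lambda>m. J (nat \<bar>n - m\<bar>)"] J
  have left: "((\<lambda>m. J (nat \<bar>n - m\<bar>)) has_sum kernel_sum J) {..<n}"
    by simp
  have "{n<..} \<inter> {..<n} = {}" and eq: "{n<..} \<union> {..<n} = - {n}"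
    by auto
  from has_sum_Un_disjoint[OF right left this(1)] show ?thesis
    unfolding eq by simp
qed

text \<open>Boundedness of \<open>f\<close> makes the kernel-weighted series absolutely summable, so
  the series of differences may be split.\<close>

lemma nonlocal_op_bounded:
  assumes J: "J summable_on {1..}" "\<And>n. 1 \<le> n \<Longrightarrow> 0 \<le> J n" and f: "\<And>m. \<bar>f m\<bar> \<le> M"
  shows "(\<lambda>m. J (nat \<bar>n - m\<bar>) * f m) summable_on (- {n})"
    and "nonlocal_op J f n
           = 2 * kernel_sum J * f n - (\<Sum>\<^sub>\<infinity>m\<in>- {n}. J (nat \<bar>n - m\<bar>) * f m)"
proof -
  note S = lattice_kernel_has_sum[OF J(1), of n]
  have J0: "0 \<le> J (nat \<bar>n - m\<bar>)" if "m \<in> - {n}" for m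
    using that by (intro J(2)) auto
  have "(\<lambda>m. J (nat \<bar>n - m\<bar>) * M) summable_on (- {n})"
    using S by (intro summable_on_cmult_left) (auto simp: summable_on_def)
  then have "(\<lambda>m. norm (J (nat \<bar>n - m\<bar>) * f m)) summable_on (- {n})"
    by (rule summable_on_comparison_test) (auto simp: abs_mult intro!: mult_mono f J0)
  then show summ: "(\<lambda>m. J (nat \<bar>n - m\<bar>) * f m) summable_on (- {n})"
    by (rule abs_summable_summable)
  have "((\<lambda>m. J (nat \<bar>n - m\<bar>) * f n + - (J (nat \<bar>n - m\<bar>) * f m)) has_sum
      2 * kernel_sum J * f n + - (\<Sum>\<^sub>\<infinity>m\<in>- {n}. J (nat \<bar>n - m\<bar>) * f m)) (- {n})"
    by (intro has_sum_add has_sum_uminusI has_sum_cmult_left S has_sum_infsum summ)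
  then show "nonlocal_op J f n
           = 2 * kernel_sum J * f n - (\<Sum>\<^sub>\<infinity>m\<in>- {n}. J (nat \<bar>n - m\<bar>) * f m)"
    unfolding nonlocal_op_def by (intro infsumI) (simp add: right_diff_distrib)
qed

text \<open>Reduces the site \<open>- i\<close> to the site \<open>p + i\<close>.\<close>

lemma nonlocal_op_reflect:
  assumes "\<And>m. f (p - m) = f m"
  shows "nonlocal_op J f (p - n) = nonlocal_op J f n"
proof -
  have "bij_betw (\<lambda>m. p - m) (- {n}) (- {p - n})"
    by (rule bij_betwI[of _ _ _ "\<lambda>m. p - m"]) auto
  from infsum_reindex_bij_betw[OF this, of "\<lambda>m. J (nat \<bar>p - n - m\<bar>) * (f (p - n) - f m)"]
  show ?thesis
    by (simp add: nonlocal_op_def assms abs_minus_commute)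
qed

text \<open>Interaction of sequences symmetric under \<open>m \<mapsto> p - m\<close>, with the index \<open>j\<close> standing for the
  sites \<open>p + j\<close> and \<open>- j\<close>. The onsite case is \<open>p = 0\<close>, where these coincide for \<open>j = 0\<close>; the offsite
  case is \<open>p = 1\<close>.\<close>

definition folded :: "(nat \<Rightarrow> real) \<Rightarrow> nat \<Rightarrow> nat \<Rightarrow> nat \<Rightarrow> real" where
  "folded J p i j = (if i = j then 0 else J (nat \<bar>int i - int j\<bar>))
                    + (if p = 0 \<and> j = 0 then 0 else J (i + j + p))"

text \<open>Grouping the sites \<open>p + j\<close> and \<open>- j\<close>, where \<open>f\<close>
  takes the same value, turns the lattice sum into a sum over indices; their distances from
  \<open>p + i\<close> are \<open>|i - j|\<close> and \<open>i + j + p\<close>.\<close>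

lemma nonlocal_op_folded:
  assumes J: "J summable_on {1..}" "\<And>n. 1 \<le> n \<Longrightarrow> 0 \<le> J n"
    and p: "p \<le> 1"
    and q: "\<And>j. \<bar>q j\<bar> \<le> M"
    and f: "\<And>j. f (int p + int j) = q j" "\<And>j. f (- int j) = q j"
  shows "nonlocal_op J f (int p + int i)
           = 2 * kernel_sum J * q i - (\<Sum>\<^sub>\<infinity>j. folded J p i j * q j)"
proof -
  define n where "n = int p + int i"
  define h where "h = (\<lambda>m. J (nat \<bar>n - m\<bar>) * f m)"
  \<comment> \<open>\<open>A\<close> consists of the sites from \<open>p\<close> on other than
    \<open>n\<close>, \<open>B\<close> of the mirror sites. For \<open>p = 0\<close> the index
    \<open>0\<close> is left out of \<open>B\<close>, as the central site would be counted twice;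
    \<open>p \<le> 1\<close> leaves no site between the two halves.\<close>
  define A where "A = (\<lambda>j. int p + int j) ` (- {i})"
  define B where "B = (\<lambda>j. - int j) ` (if p = 0 then {1..} else UNIV)"
  have split: "m \<in> A \<union> B \<longleftrightarrow> m \<noteq> n" for m
  proof (cases "int p \<le> m")
    case True
    then obtain k where "m = int p + int k"
      by (metis zle_iff_zadd)
    then show ?thesis
      unfolding A_def B_def n_def using p
      by (auto simp: image_iff split: if_splits)
  next
    case False
    then have "m = - int (nat (- m))" using p by simp
    then obtain k where "m = - int k" by blast
    then show ?thesis
      unfolding A_def B_def n_def using p False
      by (auto simp: image_iff split: if_splits)
  qed
  then have AB: "- {n} = A \<union> B" by auto
  have disj: "A \<inter> B = {}"
    unfolding A_def B_def using p by (auto split: if_splits)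
  have fM: "\<bar>f m\<bar> \<le> M" for m
  proof (cases "int p \<le> m")
    case True
    then show ?thesis using f(1)[of "nat (m - int p)"] q by simp
  next
    case False
    then show ?thesis using f(2)[of "nat (- m)"] q p by simp
  qed
  note op = nonlocal_op_bounded[where J = J and f = f and M = M and n = n, OF J fM]
  have hs: "h summable_on A \<union> B"
    using op(1) by (simp add: h_def AB)
  have hA: "h summable_on A" and hB: "h summable_on B"
    by (rule summable_on_subset_banach[OF hs]; simp)+
  let ?a = "\<lambda>j. (if i = j then 0 else J (nat \<bar>int i - int j\<bar>)) * q j"
  let ?b = "\<lambda>j. (if p = 0 \<and> j = 0 then 0 else J (i + j + p)) * q j"
  have injA: "inj_on (\<lambda>j. int p + int j) (- {i})"
    and injB: "inj_on (\<lambda>j. - int j) (if p = 0 then {1..} else UNIV)"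
    by (auto simp: inj_on_def)
  have ha: "h (int p + int j) = J (nat \<bar>int i - int j\<bar>) * q j" for j
    by (simp add: h_def n_def f)
  have hb: "h (- int j) = J (i + j + p) * q j" for j
    by (simp add: h_def n_def f nat_add_distrib add_ac)
  have a: "(?a has_sum infsum h A) UNIV"
  proof -
    have "(h \<circ> (\<lambda>j. int p + int j) has_sum infsum h A) (- {i})"
      using has_sum_infsum[OF hA] unfolding A_def has_sum_reindex[OF injA] .
    \<comment> \<open>The zero cases in \<open>folded\<close> extend the sum to all indices.\<close>
    then show ?thesis
      by (rule has_sum_cong_neutral[THEN iffD1, rotated -1]) (auto simp: ha)
  qed
  have b: "(?b has_sum infsum h B) UNIV"
  proof -
    have "(h \<circ> (\<lambda>j. - int j) has_sum infsum h B) (if p = 0 then {1..} else UNIV)"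
      using has_sum_infsum[OF hB] unfolding B_def has_sum_reindex[OF injB] .
    then show ?thesis
      by (rule has_sum_cong_neutral[THEN iffD1, rotated -1]) (auto simp: hb split: if_splits)
  qed
  have "((\<lambda>j. folded J p i j * q j) has_sum infsum h A + infsum h B) UNIV"
    using has_sum_add[OF a b] by (simp add: folded_def distrib_right)
  then have "(\<Sum>\<^sub>\<infinity>j. folded J p i j * q j) = infsum h (- {n})"
    unfolding AB infsum_Un_disjoint[OF hA hB disj] by (rule infsumI)
  then show ?thesis
    using op(2) f(1)[of i] by (simp add: h_def n_def)
qed

section \<open>Power bounds for kernels\<close>

lemma alpha_kernel_le_decay:
  assumes "alpha_kernel \<alpha> J"
  obtains C where "0 < C" "\<And>n. 1 \<le> n \<Longrightarrow> J n \<le> C * decay (1 + \<alpha>) n"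
proof -
  obtain l where "(\<lambda>n. real n powr (1 + \<alpha>) * J n) \<longlonglongrightarrow> l"
    using assms by (auto simp: alpha_kernel_def)
  then have "Bseq (\<lambda>n. real n powr (1 + \<alpha>) * J n)"
    by (intro convergent_imp_Bseq convergentI)
  then obtain C where C: "0 < C" "\<And>n. norm (real n powr (1 + \<alpha>) * J n) \<le> C"
    by (auto elim: BseqE)
  have "J n \<le> C * decay (1 + \<alpha>) n" if "1 \<le> n" for n
  proof -
    have "real n powr (1 + \<alpha>) * J n \<le> C"
      using C(2)[of n] by (simp add: abs_le_iff)
    then show ?thesis
      using that by (simp add: decay_def powr_minus_divide field_simps del: minus_add_distrib)
  qed
  with C(1) show ?thesis by (rule that)
qed

lemma alpha_kernel_summable:
  assumes "0 < \<alpha>" "alpha_kernel \<alpha> J"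
  shows "J summable_on {1..}"
proof -
  obtain C where C: "\<And>n. 1 \<le> n \<Longrightarrow> J n \<le> C * decay (1 + \<alpha>) n"
    using alpha_kernel_le_decay[OF assms(2)] by blast
  have "(\<lambda>n. C * decay (1 + \<alpha>) n) summable_on {1..}"
    using assms(1) by (intro summable_on_cmult_right decay_summable) auto
  then show ?thesis
    by (rule summable_on_comparison_test) (use C assms(2) in \<open>auto simp: alpha_kernel_def\<close>)
qed

text \<open>Meant for \<open>X n\<close> the coupling to the centre, which in the offsite case can
  be positive where \<open>J n\<close> vanishes. The limit handles all large \<open>n\<close>; the
  finitely many others have a positive minimum.\<close>

lemma alpha_kernel_decay_le:
  assumes J: "alpha_kernel \<alpha> J" and le: "\<And>n. 1 \<le> n \<Longrightarrow> J n \<le> X n"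
    and pos: "\<And>n. 1 \<le> n \<Longrightarrow> 0 < X n"
  obtains c where "0 < c" "\<And>n. 1 \<le> n \<Longrightarrow> c * decay (1 + \<alpha>) n \<le> X n"
proof -
  let ?Y = "\<lambda>n. real n powr (1 + \<alpha>) * X n"
  obtain l where l: "0 < l" "(\<lambda>n. real n powr (1 + \<alpha>) * J n) \<longlonglongrightarrow> l"
    using J by (auto simp: alpha_kernel_def)
  have "\<forall>\<^sub>F n in sequentially. l / 2 < real n powr (1 + \<alpha>) * J n"
    using order_tendstoD(1)[OF l(2), of "l / 2"] l(1) by simp
  then obtain N where N: "\<And>n. N \<le> n \<Longrightarrow> l / 2 < real n powr (1 + \<alpha>) * J n"
    by (auto simp: eventually_sequentially)
  define c where "c = Min (insert (l / 2) (?Y ` {1..N}))"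
  have "0 < c"
    unfolding c_def using l(1) by (subst Min_gr_iff) (auto intro!: mult_pos_pos pos)
  moreover have "c * decay (1 + \<alpha>) n \<le> X n" if "1 \<le> n" for n
  proof -
    have "c \<le> ?Y n"
    proof (cases "n \<le> N")
      case True
      with that show ?thesis
        unfolding c_def by (intro Min_le) auto
    next
      case False
      have "c \<le> l / 2"
        unfolding c_def by (intro Min_le) auto
      also have "l / 2 \<le> real n powr (1 + \<alpha>) * J n"
        using N[of n] False by simp
      also have "\<dots> \<le> ?Y n"
        using le[OF that] by (intro mult_left_mono) auto
      finally show ?thesis .
    qed
    then show ?thesis
      using that by (simp add: decay_def powr_minus_divide field_simps del: minus_add_distrib)
  qed
  ultimately show ?thesis by (rule that)
qed

text \<open>\<open>pos\<close> is positivity of the coupling to the centre, the source of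
  \<open>c\<close>. The reflected distance \<open>i + j + p\<close> is at least
  \<open>|i - j|\<close>, so both parts of \<open>folded\<close> obey the same decay bound, whence
  \<open>2 * C\<close>.\<close>

lemma folded_kernel_estimates:
  assumes \<alpha>: "0 < \<alpha>" and J: "alpha_kernel \<alpha> J" and p: "p \<le> 1"
    and pos: "\<And>n. 1 \<le> n \<Longrightarrow> 0 < J n + (if p = 0 then 0 else J (n + p))"
  obtains C c where "kernel_estimates (folded J p) (1 + \<alpha>) C c (kernel_sum J)"
proof -
  have J0: "0 \<le> J n" if "1 \<le> n" for n
    using J that by (simp add: alpha_kernel_def)
  obtain C where C: "0 < C" "\<And>n. 1 \<le> n \<Longrightarrow> J n \<le> C * decay (1 + \<alpha>) n"
    using alpha_kernel_le_decay[OF J] by blast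
  obtain c where c: "0 < c"
    "\<And>n. 1 \<le> n \<Longrightarrow> c * decay (1 + \<alpha>) n \<le> J n + (if p = 0 then 0 else J (n + p))"
    by (rule alpha_kernel_decay_le[OF J _ pos]) (auto simp: J0)
  have refl: "0 \<le> (if p = 0 \<and> j = 0 then 0 else J (i + j + p))" for i j
    using J0[of "i + j + p"] by auto
  have refl_le: "(if p = 0 \<and> j = 0 then 0 else J (i + j + p)) \<le> C * decay (1 + \<alpha>) k"
    if "1 \<le> k" "k \<le> i + j" for i j k
  proof (cases "p = 0 \<and> j = 0")
    case True
    with C(1) show ?thesis by simp
  next
    case False
    have "J (i + j + p) \<le> C * decay (1 + \<alpha>) (i + j + p)"
      using that by (intro C(2)) auto
    also have "\<dots> \<le> C * decay (1 + \<alpha>) k"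
      using that C(1) \<alpha> by (intro mult_left_mono decay_antimono) auto
    finally show ?thesis
      using False by auto
  qed
  have le: "folded J p i j \<le> 2 * C * decay (1 + \<alpha>) k"
    if "i \<noteq> j" "k = nat \<bar>int i - int j\<bar>" for i j k
  proof -
    have "1 \<le> k" "k \<le> i + j" using that by auto
    from C(2)[OF this(1)] refl_le[OF this] that show ?thesis
      unfolding folded_def by simp
  qed
  have "kernel_estimates (folded J p) (1 + \<alpha>) (2 * C) c (kernel_sum J)"
  proof
    show "0 \<le> folded J p i j" for i j
      using refl[of j i] J0[of "nat \<bar>int i - int j\<bar>"] unfolding folded_def by auto
    show "c * decay (1 + \<alpha>) i \<le> folded J p i 0" if "0 < i" for i
      using c(2)[of i] that by (auto simp: folded_def)
    show "folded J p i i \<le> kernel_sum J" for i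
    proof (cases "p = 0 \<and> i = 0")
      case True
      then show ?thesis
        unfolding folded_def kernel_sum_def by (auto intro!: infsum_nonneg J0)
    next
      case False
      \<comment> \<open>On the diagonal only the coupling to the mirror site remains, a single term
        of the kernel sum.\<close>
      have "sum J {i + i + p} \<le> kernel_sum J"
        unfolding kernel_sum_def using False alpha_kernel_summable[OF \<alpha> J]
        by (intro finite_sum_le_infsum) (auto intro: J0)
      then show ?thesis
        using False by (auto simp: folded_def)
    qed
  qed (use \<alpha> C(1) c(1) in \<open>auto intro!: le\<close>)
  then show ?thesis by (rule that)
qed

section \<open>The limit of vanishing ratio\<close>

lemma eventually_ratio_to_0:
  assumes "0 < \<delta>" "\<And>\<epsilon> \<omega>. 0 < \<epsilon> \<Longrightarrow> 0 < \<omega> \<Longrightarrow> \<epsilon> / \<omega> < \<delta> \<Longrightarrow> P (\<epsilon>, \<omega>)"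
  shows "eventually P ratio_to_0"
proof -
  have "\<forall>\<^sub>F x in filtercomap (\<lambda>(\<epsilon>, \<omega>). \<epsilon> / \<omega>) (nhds 0). (case x of (\<epsilon>, \<omega>) \<Rightarrow> \<epsilon> / \<omega>) < \<delta>"
    using eventually_filtercomapI[OF order_tendstoD(2)[OF filterlim_ident assms(1)]] .
  then show ?thesis
    unfolding ratio_to_0_def eventually_inf_principal
    by (rule eventually_mono) (auto intro: assms(2))
qed

lemma tendsto_ratio_to_0: "((\<lambda>(\<epsilon>, \<omega>). \<epsilon> / \<omega>) \<longlongrightarrow> 0) ratio_to_0"
  unfolding ratio_to_0_def by (rule filterlim_mono[OF filterlim_filtercomap order_refl inf_le1])

text \<open>Treats both cases at once: \<open>F\<close> is the sequence on the lattice,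
  \<open>q\<close> its values by folded index.\<close>

lemma folded_profile_asymptotics:
  fixes F :: "real \<Rightarrow> real \<Rightarrow> int \<Rightarrow> real" and q :: "real \<Rightarrow> real \<Rightarrow> nat \<Rightarrow> real"
  assumes \<alpha>: "0 < \<alpha>" and J: "alpha_kernel \<alpha> J" and p: "p \<le> 1"
    and pos: "\<And>n. 1 \<le> n \<Longrightarrow> 0 < J n + (if p = 0 then 0 else J (n + p))"
    and F: "\<And>\<epsilon> \<omega> i. F \<epsilon> \<omega> (int p + int i) = q \<epsilon> \<omega> i" "\<And>\<epsilon> \<omega> i. F \<epsilon> \<omega> (- int i) = q \<epsilon> \<omega> i"
    and q_0: "\<And>\<epsilon> \<omega>. q \<epsilon> \<omega> 0 = sqrt (\<omega> + \<epsilon> * (2 * kernel_sum J - folded J p 0 0))"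
    and q_rec: "\<And>\<epsilon> \<omega> i. 0 < i \<Longrightarrow> q \<epsilon> \<omega> i = \<epsilon> * (\<Sum>j<i. folded J p i j * q \<epsilon> \<omega> j)
                            / (\<epsilon> * (2 * kernel_sum J - folded J p i i) + \<omega>)"
  shows "int p \<le> n \<Longrightarrow> (\<lambda>(\<epsilon>, \<omega>). F \<epsilon> \<omega> (n + 1)) \<in> O[ratio_to_0](\<lambda>(\<epsilon>, \<omega>). F \<epsilon> \<omega> n)"
    and "((\<lambda>(\<epsilon>, \<omega>). stationary_defect J \<epsilon> \<omega> (F \<epsilon> \<omega>)) \<longlongrightarrow> 0) ratio_to_0"
proof -
  obtain C c where "kernel_estimates (folded J p) (1 + \<alpha>) C c (kernel_sum J)"
    using folded_kernel_estimates[OF \<alpha> J p pos] by blast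
  \<comment> \<open>Interpreted before \<open>\<epsilon>\<close> and \<open>\<omega>\<close> are
    fixed, so that one threshold and one pair of bounds serve all of them.\<close>
  then interpret kernel_estimates "folded J p" "1 + \<alpha>" C c "kernel_sum J" .
  have profile: "profile (folded J p) (1 + \<alpha>) C c (kernel_sum J) \<epsilon> \<omega> (q \<epsilon> \<omega>)"
    if "0 < \<epsilon>" "0 < \<omega>" "\<epsilon> / \<omega> < threshold" for \<epsilon> \<omega>
    by unfold_locales (fact that q_0 q_rec)+
  {
    assume "int p \<le> n"
    then have n: "n = int p + int (nat (n - int p))"
      "n + 1 = int p + int (Suc (nat (n - int p)))"
      by auto
    show "(\<lambda>(\<epsilon>, \<omega>). F \<epsilon> \<omega> (n + 1)) \<in> O[ratio_to_0](\<lambda>(\<epsilon>, \<omega>). F \<epsilon> \<omega> n)"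
    proof (rule bigoI[of _ ratio_bound], rule eventually_ratio_to_0[OF threshold_pos])
      fix \<epsilon> \<omega> :: real assume *: "0 < \<epsilon>" "0 < \<omega>" "\<epsilon> / \<omega> < threshold"
      interpret profile "folded J p" "1 + \<alpha>" C c "kernel_sum J" \<epsilon> \<omega> "q \<epsilon> \<omega>"
        by (rule profile[OF *])
      have "F \<epsilon> \<omega> (n + 1) = q \<epsilon> \<omega> (Suc (nat (n - int p)))"
        "F \<epsilon> \<omega> n = q \<epsilon> \<omega> (nat (n - int p))"
        using F(1)[of \<epsilon> \<omega>] n by metis+
      then show "norm (case (\<epsilon>, \<omega>) of (\<epsilon>, \<omega>) \<Rightarrow> F \<epsilon> \<omega> (n + 1))
          \<le> ratio_bound * norm (case (\<epsilon>, \<omega>) of (\<epsilon>, \<omega>) \<Rightarrow> F \<epsilon> \<omega> n)"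
        using q_above[OF lessI, of "nat (n - int p)"] q_nonneg by simp
    qed
  }
  have defect: "stationary_defect J \<epsilon> \<omega> (F \<epsilon> \<omega>) \<le> ereal (defect_bound * (\<epsilon> / \<omega>))"
    if *: "0 < \<epsilon>" "0 < \<omega>" "\<epsilon> / \<omega> < threshold" for \<epsilon> \<omega>
  proof -
    interpret profile "folded J p" "1 + \<alpha>" C c "kernel_sum J" \<epsilon> \<omega> "q \<epsilon> \<omega>"
      by (rule profile[OF *])
    let ?f = "F \<epsilon> \<omega>"
    obtain M where M: "\<And>j. \<bar>q \<epsilon> \<omega> j\<bar> \<le> M"
      using q_bounded by blast
    have sites: "\<exists>i. m = int p + int i \<or> m = - int i" for m
    proof (cases "int p \<le> m")
      case True
      then show ?thesis by (intro exI[of _ "nat (m - int p)"]) simp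
    next
      case False
      then show ?thesis using p by (intro exI[of _ "nat (- m)"]) simp
    qed
    have sym: "?f (int p - m) = ?f m" for m
      using sites[of m] F[of \<epsilon> \<omega>] by auto
    have op: "nonlocal_op J ?f (int p + int i)
        = 2 * kernel_sum J * q \<epsilon> \<omega> i - (\<Sum>\<^sub>\<infinity>j. folded J p i j * q \<epsilon> \<omega> j)" for i
      by (rule nonlocal_op_folded[where M = M])
        (use J alpha_kernel_summable[OF \<alpha> J] p in \<open>auto simp: alpha_kernel_def M F\<close>)
    have "\<bar>(- \<omega> * ?f m) / (\<epsilon> * nonlocal_op J ?f m - ?f m ^ 3) - 1\<bar> \<le> defect_bound * (\<epsilon> / \<omega>)" for m
    proof -
      obtain i where i: "m = int p + int i \<or> m = - int i"
        using sites by blast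
      have "nonlocal_op J ?f m = nonlocal_op J ?f (int p + int i)"
        using i nonlocal_op_reflect[of ?f "int p" J "int p + int i", OF sym] by auto
      moreover have "?f m = q \<epsilon> \<omega> i"
        using i F by auto
      ultimately show ?thesis
        using defect_le[of i] by (simp add: op)
    qed
    then show ?thesis
      unfolding stationary_defect_def by (intro SUP_least) simp
  qed
  have "((\<lambda>x. ereal (defect_bound * (case x of (\<epsilon>, \<omega>) \<Rightarrow> \<epsilon> / \<omega>))) \<longlongrightarrow> ereal (defect_bound * 0))
      ratio_to_0"
    by (intro tendsto_intros tendsto_ratio_to_0)
  then have lim: "((\<lambda>(\<epsilon>, \<omega>). ereal (defect_bound * (\<epsilon> / \<omega>))) \<longlongrightarrow> 0) ratio_to_0"
    by (simp add: case_prod_unfold zero_ereal_def)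
  have "\<forall>\<^sub>F x in ratio_to_0. (case x of (\<epsilon>, \<omega>) \<Rightarrow> stationary_defect J \<epsilon> \<omega> (F \<epsilon> \<omega>))
      \<le> (case x of (\<epsilon>, \<omega>) \<Rightarrow> ereal (defect_bound * (\<epsilon> / \<omega>)))"
    by (rule eventually_ratio_to_0[OF threshold_pos]) (simp only: prod.case defect)
  \<comment> \<open>The absolute value at a single site, here \<open>0\<close>, gives the lower half
    of the sandwich.\<close>
  moreover have "0 \<le> stationary_defect J \<epsilon> \<omega> f" for \<epsilon> \<omega> f
    unfolding stationary_defect_def by (rule SUP_upper2[of 0]) auto
  then have "\<forall>\<^sub>F x in ratio_to_0. 0 \<le> (case x of (\<epsilon>, \<omega>) \<Rightarrow> stationary_defect J \<epsilon> \<omega> (F \<epsilon> \<omega>))"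
    by (simp add: split_beta)
  ultimately show "((\<lambda>(\<epsilon>, \<omega>). stationary_defect J \<epsilon> \<omega> (F \<epsilon> \<omega>)) \<longlongrightarrow> 0) ratio_to_0"
    by (intro tendsto_sandwich[OF _ _ tendsto_const lim])
qed

section \<open>The onsite and offsite recursions in folded form\<close>

lemma folded_below:
  assumes "j < i"
  shows "folded J p i j = J (i - j) + (if p = 0 \<and> j = 0 then 0 else J (i + j + p))"
proof -
  have "nat \<bar>int i - int j\<bar> = i - j"
    using assms by arith
  with assms show ?thesis
    by (simp add: folded_def)
qed

lemma onsite_nat_0:
  "onsite_nat J \<epsilon> \<omega> 0 = sqrt (\<omega> + \<epsilon> * (2 * kernel_sum J - folded J 0 0 0))"
  by (subst onsite_nat.simps) (simp add: folded_def)

lemma onsite_nat_rec: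
  assumes "0 < i"
  shows "onsite_nat J \<epsilon> \<omega> i = \<epsilon> * (\<Sum>j<i. folded J 0 i j * onsite_nat J \<epsilon> \<omega> j)
           / (\<epsilon> * (2 * kernel_sum J - folded J 0 i i) + \<omega>)"
proof -
  \<comment> \<open>The onsite centre is its own mirror image, so its coupling is \<open>J i\<close>
    alone and it is treated separately.\<close>
  have "(\<Sum>j<i. folded J 0 i j * onsite_nat J \<epsilon> \<omega> j)
      = (\<Sum>j\<in>insert 0 {1..<i}. folded J 0 i j * onsite_nat J \<epsilon> \<omega> j)"
    using assms by (intro sum.cong) auto
  also have "\<dots> = folded J 0 i 0 * onsite_nat J \<epsilon> \<omega> 0
      + (\<Sum>j\<in>{1..<i}. folded J 0 i j * onsite_nat J \<epsilon> \<omega> j)"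
    by simp
  also have "folded J 0 i 0 = J i"
    using assms by (simp add: folded_below)
  also have "(\<Sum>j\<in>{1..<i}. folded J 0 i j * onsite_nat J \<epsilon> \<omega> j)
      = (\<Sum>j\<in>{1..<i}. (J (i - j) + J (i + j)) * onsite_nat J \<epsilon> \<omega> j)"
    by (intro sum.cong refl) (simp add: folded_below)
  finally have sum: "(\<Sum>j<i. folded J 0 i j * onsite_nat J \<epsilon> \<omega> j) = J i * onsite_nat J \<epsilon> \<omega> 0
      + (\<Sum>j\<in>{1..<i}. (J (i - j) + J (i + j)) * onsite_nat J \<epsilon> \<omega> j)" .
  have diag: "folded J 0 i i = J (2 * i)"
    using assms by (simp add: folded_def mult_2)
  show ?thesis
    unfolding sum diag using assms by (subst onsite_nat.simps) simp
qed

lemma offsite_nat_1: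
  "offsite_nat J \<epsilon> \<omega> (Suc 0) = sqrt (\<omega> + \<epsilon> * (2 * kernel_sum J - folded J 1 0 0))"
  by (subst offsite_nat.simps) (simp add: folded_def)

lemma offsite_nat_rec:
  assumes "0 < i"
  shows "offsite_nat J \<epsilon> \<omega> (Suc i) = \<epsilon> * (\<Sum>j<i. folded J 1 i j * offsite_nat J \<epsilon> \<omega> (Suc j))
           / (\<epsilon> * (2 * kernel_sum J - folded J 1 i i) + \<omega>)"
proof -
  \<comment> \<open>With \<open>m = Suc j\<close>, the reflected distance \<open>i + j + 1\<close>
    becomes \<open>Suc i + m - 1\<close>.\<close>
  have sum: "(\<Sum>j<i. folded J 1 i j * offsite_nat J \<epsilon> \<omega> (Suc j))
      = (\<Sum>m\<in>{1..<Suc i}. (J (Suc i - m) + J (Suc i + m - 1)) * offsite_nat J \<epsilon> \<omega> m)"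
    by (rule sum.reindex_bij_witness[of _ "\<lambda>m. m - 1" Suc]) (auto simp: folded_below)
  have diag: "folded J 1 i i = J (2 * Suc i - 1)"
    by (simp add: folded_def mult_2)
  show ?thesis
    unfolding sum diag using assms by (subst offsite_nat.simps) simp
qed

theorem proposition5p5:
  fixes \<alpha> :: real and J :: "nat \<Rightarrow> real"
  assumes "0 < \<alpha>"
    and "alpha_kernel \<alpha> J"
  shows "((\<forall>n\<ge>1. 0 < J n) \<longrightarrow>
      (\<forall>n::int. n \<ge> 0 \<longrightarrow>
         (\<lambda>(\<epsilon>, \<omega>). onsite J \<epsilon> \<omega> (n + 1)) \<in> O[ratio_to_0](\<lambda>(\<epsilon>, \<omega>). onsite J \<epsilon> \<omega> n)) \<and>
      ((\<lambda>(\<epsilon>, \<omega>). stationary_defect J \<epsilon> \<omega> (onsite J \<epsilon> \<omega>)) \<longlongrightarrow> 0) ratio_to_0)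
    \<and> ((\<forall>n\<ge>1. 0 < J n + J (n + 1)) \<longrightarrow>
      (\<forall>n::int. n \<ge> 1 \<longrightarrow>
         (\<lambda>(\<epsilon>, \<omega>). offsite J \<epsilon> \<omega> (n + 1)) \<in> O[ratio_to_0](\<lambda>(\<epsilon>, \<omega>). offsite J \<epsilon> \<omega> n)) \<and>
      ((\<lambda>(\<epsilon>, \<omega>). stationary_defect J \<epsilon> \<omega> (offsite J \<epsilon> \<omega>)) \<longlongrightarrow> 0) ratio_to_0)"
proof (intro conjI impI)
  assume "\<forall>n\<ge>1. 0 < J n"
  then have pos: "0 < J n + (if (0::nat) = 0 then 0 else J (n + 0))" if "1 \<le> n" for n
    using that by simp
  have sites: "onsite J \<epsilon> \<omega> (int 0 + int i) = onsite_nat J \<epsilon> \<omega> i"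
    "onsite J \<epsilon> \<omega> (- int i) = onsite_nat J \<epsilon> \<omega> i" for \<epsilon> \<omega> i
    by (simp_all add: onsite_def)
  note asymptotics = folded_profile_asymptotics[where p = 0 and F = "onsite J" and
      q = "onsite_nat J", OF assms zero_le_one pos sites onsite_nat_0 onsite_nat_rec]
  show "\<forall>n::int. n \<ge> 0 \<longrightarrow>
      (\<lambda>(\<epsilon>, \<omega>). onsite J \<epsilon> \<omega> (n + 1)) \<in> O[ratio_to_0](\<lambda>(\<epsilon>, \<omega>). onsite J \<epsilon> \<omega> n)"
    using asymptotics(1) by simp
  show "((\<lambda>(\<epsilon>, \<omega>). stationary_defect J \<epsilon> \<omega> (onsite J \<epsilon> \<omega>)) \<longlongrightarrow> 0) ratio_to_0"
    by (rule asymptotics(2))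
next
  assume "\<forall>n\<ge>1. 0 < J n + J (n + 1)"
  then have pos: "0 < J n + (if (1::nat) = 0 then 0 else J (n + 1))" if "1 \<le> n" for n
    using that by simp
  \<comment> \<open>The central pair of sites \<open>1\<close> and \<open>0\<close> has folded index
    \<open>0\<close> but argument \<open>1\<close> in \<open>offsite_nat\<close>, hence the shift by
    \<open>Suc\<close>.\<close>
  have sites: "offsite J \<epsilon> \<omega> (int 1 + int i) = offsite_nat J \<epsilon> \<omega> (Suc i)"
    "offsite J \<epsilon> \<omega> (- int i) = offsite_nat J \<epsilon> \<omega> (Suc i)" for \<epsilon> \<omega> i
  proof -
    have "nat (1 + int i) = Suc i"
      by simp
    then show "offsite J \<epsilon> \<omega> (int 1 + int i) = offsite_nat J \<epsilon> \<omega> (Suc i)"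
      "offsite J \<epsilon> \<omega> (- int i) = offsite_nat J \<epsilon> \<omega> (Suc i)"
      by (simp_all add: offsite_def)
  qed
  note asymptotics = folded_profile_asymptotics[where p = 1 and F = "offsite J" and
      q = "\<lambda>\<epsilon> \<omega> i. offsite_nat J \<epsilon> \<omega> (Suc i)",
      OF assms order_refl pos sites offsite_nat_1 offsite_nat_rec]
  show "\<forall>n::int. n \<ge> 1 \<longrightarrow>
      (\<lambda>(\<epsilon>, \<omega>). offsite J \<epsilon> \<omega> (n + 1)) \<in> O[ratio_to_0](\<lambda>(\<epsilon>, \<omega>). offsite J \<epsilon> \<omega> n)"
    using asymptotics(1) by simp
  show "((\<lambda>(\<epsilon>, \<omega>). stationary_defect J \<epsilon> \<omega> (offsite J \<epsilon> \<omega>)) \<longlongrightarrow> 0) ratio_to_0"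
    by (rule asymptotics(2))
qed

end
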